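(* Let $\mathcal{C}\subseteq\mathbb{N}^p$ be an affine integer cone and $\preceq$ a total order on $\mathbb{N}^p$. For any $f\in\mathcal{C}\setminus\{0\}$ and any positive integer $g$, the set $\mathfrak{B}(Fb=f,\,gen=g)$ of all $\mathcal{B}$-semigroups with Frobenius element $f$ and genus $g$ is non-empty if and only if $$\left\lceil\frac{\sharp\mathcal{B}(f)}{2}\right\rceil\leq g\leq\sharp\mathcal{B}(f)-1.$$
   Context: $\mathbb{N}$ contains $0$. An affine integer cone $\mathcal{C}\subseteq\mathbb{N}^p$ is a set $L(A)\cap\mathbb{N}^p$ with $A\subseteq\mathcal{C}$ finite and non-empty, where $L(A)$ is the set of non-negative real linear combinations of elements of $A$. A $\mathcal{C}$-semigroup is a submonoid $S\subseteq\mathcal{C}$ (containing $0$) with $\mathcal{C}\setminus S$ finite; its genus is $\sharp(\mathcal{C}\setminus S)$, where $\sharp$ denotes cardinality. A total order on $\mathbb{N}^p$ means a total order relation compatible with addition and satisfying $0\preceq x$ for all $x$. For $S\ne\mathcal{C}$, $\mathrm{Fb}(S)=\max_\preceq(\mathcal{C}\setminus S)$. Write $x\leq_{\mathcal{C}}y$ if $y-x\in\mathcal{C}$, and $\mathcal{B}(f)=\{x\in\mathcal{C}\mid x\leq_{\mathcal{C}}f\}$. A $\mathcal{B}$-semigroup with Frobenius element $f$ is a $\mathcal{C}$-semigroup $S$ with $\mathrm{Fb}(S)=f$ and $S=S\cup(\mathcal{C}\setminus\mathcal{B}(f))$. *)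

theory Defs
  imports "HOL-Analysis.Finite_Cartesian_Product"
begin

definition real_vec :: "nat ^ 'p \<Rightarrow> real ^ 'p" where
  "real_vec x = (\<chi> i. real (x $ i))"

definition nonneg_span :: "(nat ^ 'p) set \<Rightarrow> (real ^ 'p) set" where
  "nonneg_span A = {\<Sum>a\<in>A. c a *\<^sub>R real_vec a | c. \<forall>a\<in>A. 0 \<le> c a}"

definition affine_integer_cone :: "(nat ^ 'p) set \<Rightarrow> bool" where
  "affine_integer_cone C \<longleftrightarrow>
     (\<exists>A. A \<subseteq> C \<and> finite A \<and> A \<noteq> {} \<and> C = {x. real_vec x \<in> nonneg_span A})"

definition monoid_total_order :: "(nat ^ 'p \<Rightarrow> nat ^ 'p \<Rightarrow> bool) \<Rightarrow> bool" where
  "monoid_total_order le \<longleftrightarrow>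
     linear_order {(x, y). le x y} \<and>
     (\<forall>x y z. le x y \<longrightarrow> le (x + z) (y + z)) \<and>
     (\<forall>x. le 0 x)"

definition C_semigroup :: "(nat ^ 'p) set \<Rightarrow> (nat ^ 'p) set \<Rightarrow> bool" where
  "C_semigroup C S \<longleftrightarrow>
     S \<subseteq> C \<and> 0 \<in> S \<and> (\<forall>x\<in>S. \<forall>y\<in>S. x + y \<in> S) \<and> finite (C - S)"

definition genus :: "(nat ^ 'p) set \<Rightarrow> (nat ^ 'p) set \<Rightarrow> nat" where
  "genus C S = card (C - S)"

text \<open>The maximum of \<open>C - S\<close> for \<open>le\<close>; unspecified if \<open>S = C\<close>.\<close>

definition Fb :: "(nat ^ 'p \<Rightarrow> nat ^ 'p \<Rightarrow> bool) \<Rightarrow> (nat ^ 'p) set \<Rightarrow> (nat ^ 'p) set \<Rightarrow> nat ^ 'p" where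
  "Fb le C S = order.Greatest le (\<lambda>x. x \<in> C - S)"

text \<open>\<open>y - x\<close> must be read in the integers: subtraction on \<open>nat ^ 'p\<close> truncates,
  so membership of the difference in \<open>C\<close> is expressed additively.\<close>

definition cone_le :: "(nat ^ 'p) set \<Rightarrow> nat ^ 'p \<Rightarrow> nat ^ 'p \<Rightarrow> bool" where
  "cone_le C x y \<longleftrightarrow> (\<exists>c\<in>C. y = x + c)"

definition cone_box :: "(nat ^ 'p) set \<Rightarrow> nat ^ 'p \<Rightarrow> (nat ^ 'p) set" where
  "cone_box C f = {x \<in> C. cone_le C x f}"

text \<open>\<open>S \<noteq> C\<close> is stated explicitly because the Frobenius element exists only in that case.\<close>

definition B_semigroup ::
  "(nat ^ 'p \<Rightarrow> nat ^ 'p \<Rightarrow> bool) \<Rightarrow> (nat ^ 'p) set \<Rightarrow> nat ^ 'p \<Rightarrow> (nat ^ 'p) set \<Rightarrow> bool" where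
  "B_semigroup le C f S \<longleftrightarrow>
     C_semigroup C S \<and> S \<noteq> C \<and> Fb le C S = f \<and> S = S \<union> (C - cone_box C f)"

definition B_semigroups ::
  "(nat ^ 'p \<Rightarrow> nat ^ 'p \<Rightarrow> bool) \<Rightarrow> (nat ^ 'p) set \<Rightarrow> nat ^ 'p \<Rightarrow> nat \<Rightarrow> (nat ^ 'p) set set" where
  "B_semigroups le C f g = {S. B_semigroup le C f S \<and> genus C S = g}"

end

theory Submission
  imports Defs
begin

text \<open>
  The map \<open>x \<mapsto> f - x\<close> is an order-reversing involution of the box \<open>\<B>(f)\<close>. As \<open>f\<close> is a gap, each
  pair \<open>{x, f - x}\<close> contains a gap, which gives the lower bound on the genus; \<open>0\<close> is not a gap,
  which gives the upper bound. Conversely, let \<open>U\<close> consist of the \<open>\<sharp>\<B>(f) - g\<close> largest elements of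
  \<open>\<B>(f)\<close> and let the gaps be \<open>f\<close> and the non-zero elements of \<open>\<B>(f) - U\<close>. If two elements \<open>x, y\<close> of
  \<open>U\<close> had their sum in the box, then \<open>y \<preceq> f - x\<close> would put \<open>f - x\<close> in \<open>U\<close>, so that \<open>U\<close> and its mirror
  image \<open>f - U\<close> would overlap and cover \<open>\<B>(f)\<close>, which is impossible when \<open>\<sharp>\<B>(f) \<le> 2 g\<close>.
\<close>

section \<open>Upward closed subsets of prescribed size\<close>

lemma (in linorder) ex_upper_subset_card:
  assumes "finite B" "k \<le> card B"
  shows "\<exists>U \<subseteq> B. card U = k \<and> (\<forall>x\<in>U. \<forall>y\<in>B. x \<le> y \<longrightarrow> y \<in> U)"
  using assms(2)
proof (induction k)
  case 0
  show ?case by (intro exI[of _ "{}"]) simp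
next
  case (Suc k)
  then obtain U where U: "U \<subseteq> B" "card U = k" "\<And>x y. x \<in> U \<Longrightarrow> y \<in> B \<Longrightarrow> x \<le> y \<Longrightarrow> y \<in> U"
    by (meson Suc_leD)
  have fU: "finite U" using U(1) assms(1) finite_subset by blast
  have "B - U \<noteq> {}" using U(1,2) Suc.prems by auto
  \<comment> \<open>Adjoining the largest element not yet taken keeps the set upward closed.\<close>
  then have m: "Max (B - U) \<in> B - U" using assms(1) by (intro Max_in) auto
  have "y \<in> insert (Max (B - U)) U" if "x \<in> insert (Max (B - U)) U" "y \<in> B" "x \<le> y" for x y
  proof (cases "y \<in> U")
    case False
    then have "y \<le> Max (B - U)" using that(2) assms(1) by (intro Max_ge) auto
    moreover have "x = Max (B - U)" using that U(3) False by blast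
    ultimately show ?thesis using that(3) order.antisym by blast
  qed simp
  moreover have "card (insert (Max (B - U)) U) = Suc k" using m fU U(2) by simp
  ultimately show ?case using m U(1) by (intro exI[of _ "insert (Max (B - U)) U"]) blast
qed

section \<open>The cone as a monoid\<close>

lemma real_vec_add: "real_vec (x + y) = real_vec x + real_vec y"
  by (simp add: real_vec_def vec_eq_iff)

lemma nonneg_span_add:
  assumes "u \<in> nonneg_span A" "v \<in> nonneg_span A"
  shows "u + v \<in> nonneg_span A"
proof -
  obtain c d where "u = (\<Sum>a\<in>A. c a *\<^sub>R real_vec a)" "\<forall>a\<in>A. 0 \<le> c a"
    "v = (\<Sum>a\<in>A. d a *\<^sub>R real_vec a)" "\<forall>a\<in>A. 0 \<le> d a"
    using assms unfolding nonneg_span_def by blast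
  then have "u + v = (\<Sum>a\<in>A. (c a + d a) *\<^sub>R real_vec a)" "\<forall>a\<in>A. 0 \<le> c a + d a"
    by (simp_all add: scaleR_add_left sum.distrib)
  then show ?thesis
    unfolding nonneg_span_def by (intro CollectI exI[of _ "\<lambda>a. c a + d a"]) simp
qed

lemma affine_integer_cone_add:
  assumes "affine_integer_cone C" "x \<in> C" "y \<in> C"
  shows "x + y \<in> C"
  using assms unfolding affine_integer_cone_def by (auto simp: real_vec_add nonneg_span_add)

lemma zero_in_affine_integer_cone:
  assumes "affine_integer_cone C"
  shows "0 \<in> C"
proof -
  obtain A where A: "C = {x. real_vec x \<in> nonneg_span A}"
    using assms unfolding affine_integer_cone_def by blast
  have "real_vec 0 = (\<Sum>a\<in>A. (0::real) *\<^sub>R real_vec a)" by (simp add: real_vec_def vec_eq_iff)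
  then have "real_vec 0 \<in> nonneg_span A"
    unfolding nonneg_span_def by (intro CollectI exI[of _ "\<lambda>_. 0"]) simp
  then show ?thesis using A by blast
qed

section \<open>The box below \<open>f\<close> and its reflection\<close>

lemma mem_cone_box_iff: "x \<in> cone_box C f \<longleftrightarrow> x \<in> C \<and> (\<exists>c\<in>C. f = x + c)"
  by (simp add: cone_box_def cone_le_def)

text \<open>Each coordinate of a box element is at most that of \<open>f\<close>, so the box embeds
  into a finite product of intervals.\<close>

lemma finite_cone_box: "finite (cone_box C f)"
proof -
  have "x $ i \<in> {..f $ i}" if "x \<in> cone_box C f" for x i
    using that by (auto simp: mem_cone_box_iff)
  then have "($) ` cone_box C f \<subseteq> (\<Pi>\<^sub>E i\<in>UNIV. {..f $ i})"
    by (auto simp: PiE_def)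
  moreover have "finite (\<Pi>\<^sub>E i\<in>(UNIV :: 'a set). {..f $ i})" by (intro finite_PiE) auto
  ultimately have "finite (($) ` cone_box C f)" by (rule finite_subset)
  then show ?thesis by (rule finite_imageD) (simp add: inj_on_def vec_eq_iff)
qed

text \<open>Subtraction on \<open>nat ^ 'p\<close> truncates; inside the box \<open>f - x\<close> is
  the true difference, hence the cone element witnessing membership of \<open>x\<close>.\<close>

lemma cone_box_diff:
  assumes "x \<in> cone_box C f"
  shows "f - x \<in> cone_box C f" "x + (f - x) = f"
  using assms by (auto simp: mem_cone_box_iff add.commute)

text \<open>If \<open>f = x + y + c\<close>, then \<open>y + c\<close> lies in the cone and is the
  witness for \<open>x\<close>.\<close>

lemma cone_box_of_add:
  assumes "affine_integer_cone C" "x \<in> C" "y \<in> C" "x + y \<in> cone_box C f"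
  shows "x \<in> cone_box C f"
  using assms affine_integer_cone_add[OF assms(1)] unfolding mem_cone_box_iff
  by (metis add.assoc)

section \<open>The monoid order and Frobenius elements\<close>

lemma monoid_total_order_linorder:
  assumes "monoid_total_order le"
  shows "class.linorder le (\<lambda>x y. le x y \<and> \<not> le y x)"
proof -
  have lin: "linear_order {(x, y). le x y}" using assms by (simp add: monoid_total_order_def)
  then have refl: "le x x" for x
    by (auto simp: linear_order_on_def partial_order_on_def preorder_on_def refl_on_def)
  have trans: "le x z" if "le x y" "le y z" for x y z
    using lin that
    by (auto simp: linear_order_on_def partial_order_on_def preorder_on_def dest: transD)
  have antisym: "x = y" if "le x y" "le y x" for x y
    using lin that by (auto simp: linear_order_on_def partial_order_on_def dest: antisymD)
  have total: "le x y \<or> le y x" for x y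
    using lin refl by (cases "x = y") (auto simp: linear_order_on_def total_on_def)
  show ?thesis
    by unfold_locales (use refl trans antisym total in blast)+
qed

lemma Fb_eqI:
  assumes "monoid_total_order le" "x \<in> C - S" "\<And>y. y \<in> C - S \<Longrightarrow> le y x"
  shows "Fb le C S = x"
proof -
  interpret linorder le "\<lambda>x y. le x y \<and> \<not> le y x"
    by (rule monoid_total_order_linorder) fact
  show ?thesis unfolding Fb_def by (rule Greatest_equality) (use assms in auto)
qed

lemma Fb_mem:
  assumes "monoid_total_order le" "finite (C - S)" "C - S \<noteq> {}"
  shows "Fb le C S \<in> C - S"
proof -
  interpret linorder le "\<lambda>x y. le x y \<and> \<not> le y x"
    by (rule monoid_total_order_linorder) fact
  have "Fb le C S = Max (C - S)" using assms by (intro Fb_eqI Max_in Max_ge) auto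
  then show ?thesis using assms Max_in by metis
qed

text \<open>Otherwise totality gives
  \<open>f = x + (f - x) \<le> x + (f - y) \<le> y + (f - y) = f\<close> in the order
  \<open>le\<close>; the forced equality cancels to \<open>f - x = f - y\<close>, against
  reflexivity.\<close>

lemma diff_antimono_cone_box:
  assumes "monoid_total_order le" "x \<in> cone_box C f" "y \<in> cone_box C f" "le x y"
  shows "le (f - y) (f - x)"
proof -
  interpret linorder le "\<lambda>x y. le x y \<and> \<not> le y x"
    by (rule monoid_total_order_linorder) fact
  have mono: "le (a + c) (b + c)" if "le a b" for a b c
    using assms(1) that unfolding monoid_total_order_def by blast
  show ?thesis
  proof (rule ccontr)
    assume neg: "\<not> ?thesis"
    then have "le (x + (f - x)) (x + (f - y))" using linear mono[of "f - x" "f - y" x]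
      by (auto simp: add.commute)
    moreover have "le (x + (f - y)) (y + (f - y))" by (rule mono) fact
    ultimately have "x + (f - x) = x + (f - y)"
      using cone_box_diff(2) assms(2,3) order.antisym by metis
    then show False using neg by simp
  qed
qed

section \<open>Necessity of the bounds\<close>

lemma genus_bounds:
  assumes "affine_integer_cone C" "monoid_total_order le" "B_semigroup le C f S"
  shows "card (cone_box C f) \<le> 2 * genus C S" "genus C S < card (cone_box C f)"
proof -
  have S: "S \<subseteq> C" "0 \<in> S" "\<And>x y. x \<in> S \<Longrightarrow> y \<in> S \<Longrightarrow> x + y \<in> S" "finite (C - S)" "S \<noteq> C"
    "Fb le C S = f" "C - S \<subseteq> cone_box C f"
    using assms(3) unfolding B_semigroup_def C_semigroup_def by blast+
  have f: "f \<in> C - S" using Fb_mem[OF assms(2), of C S] S by auto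
  \<comment> \<open>Each box element is a gap or the reflection of one, so the box has at most twice
    as many elements as there are gaps.\<close>
  have "cone_box C f \<subseteq> (C - S) \<union> (\<lambda>x. f - x) ` (C - S)"
  proof
    fix x assume x: "x \<in> cone_box C f"
    then have "f - x \<in> C" "x \<in> C" "x = f - (f - x)"
      using cone_box_diff[OF x] by (auto simp: cone_box_def) (metis add_diff_cancel_right')
    moreover have "x \<notin> S \<or> f - x \<notin> S" using S(3) f cone_box_diff(2)[OF x] by (metis DiffD2)
    ultimately show "x \<in> (C - S) \<union> (\<lambda>x. f - x) ` (C - S)" by blast
  qed
  then have "card (cone_box C f) \<le> card ((C - S) \<union> (\<lambda>x. f - x) ` (C - S))"
    using S(4) by (intro card_mono) auto
  also have "\<dots> \<le> card (C - S) + card ((\<lambda>x. f - x) ` (C - S))" by (rule card_Un_le)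
  also have "\<dots> \<le> 2 * card (C - S)" using card_image_le[OF S(4)] by (simp add: mult_2)
  finally show "card (cone_box C f) \<le> 2 * genus C S" by (simp add: genus_def)
  have "0 \<in> cone_box C f"
    using zero_in_affine_integer_cone[OF assms(1)] f by (simp add: mem_cone_box_iff)
  then have "C - S \<subset> cone_box C f" using S by blast
  then show "genus C S < card (cone_box C f)"
    unfolding genus_def by (intro psubset_card_mono finite_cone_box)
qed

section \<open>Construction of a semigroup of given genus\<close>

lemma B_semigroup_exists:
  assumes C: "affine_integer_cone C" and le: "monoid_total_order le" and f: "f \<in> C" "f \<noteq> 0"
    and g: "card (cone_box C f) \<le> 2 * g" "g < card (cone_box C f)"
  shows "\<exists>S. B_semigroup le C f S \<and> genus C S = g"
proof -
  let ?B = "cone_box C f"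
  interpret linorder le "\<lambda>x y. le x y \<and> \<not> le y x"
    by (rule monoid_total_order_linorder) fact
  have mono: "le (a + c) (b + c)" if "le a b" for a b c
    using le that unfolding monoid_total_order_def by blast
  have le0: "le 0 x" for x using le unfolding monoid_total_order_def by blast
  have C0: "0 \<in> C" by (rule zero_in_affine_integer_cone) fact
  have fin: "finite ?B" by (rule finite_cone_box)
  have B0: "0 \<in> ?B" and Bf: "f \<in> ?B" using C0 f by (auto simp: mem_cone_box_iff)
  have Ble: "le x f" if "x \<in> ?B" for x
    using mono[OF le0, of x "f - x"] cone_box_diff(2)[OF that] by (simp add: add.commute)
  obtain U where U: "U \<subseteq> ?B" "card U = card ?B - g"
    "\<And>x y. x \<in> U \<Longrightarrow> y \<in> ?B \<Longrightarrow> le x y \<Longrightarrow> y \<in> U"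
    using ex_upper_subset_card[OF fin, of "card ?B - g"] by auto
  have fU: "finite U" using U(1) fin finite_subset by blast
  have "U \<noteq> {}" using U(2) g by auto
  then have Uf: "f \<in> U" using U Bf Ble by blast
  have "U \<noteq> ?B" using U(2) g by auto
  then have U0: "0 \<notin> U" using U(1,3) le0 by blast
  have no_pair: "f - x \<notin> U" if x: "x \<in> U" for x
  proof
    assume fx: "f - x \<in> U"
    \<comment> \<open>The point \<open>x\<close> may be dropped because its reflection
      \<open>f - x\<close> already lies in \<open>U\<close>. This makes the count strict:
      \<open>card ?B < 2 * card U\<close>, whereas the lower bound on \<open>g\<close> gives
      \<open>2 * card U \<le> card ?B\<close>.\<close>
    have "?B \<subseteq> U \<union> (\<lambda>z. f - z) ` (U - {x})"
    proof
      fix z assume z: "z \<in> ?B"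
      show "z \<in> U \<union> (\<lambda>z. f - z) ` (U - {x})"
      proof (cases "z \<in> U")
        case False
        have xB: "x \<in> ?B" using x U(1) by blast
        have "le z (f - x)" using U(3)[OF fx z] False linear by blast
        then have "le (f - (f - x)) (f - z)"
          using diff_antimono_cone_box[OF le z] cone_box_diff(1)[OF xB] by blast
        moreover have inv: "f - (f - w) = w" if "w \<in> ?B" for w
          using cone_box_diff(2)[OF that] by (metis add_diff_cancel_right')
        ultimately have "f - z \<in> U" using U(3)[OF x] cone_box_diff(1)[OF z] xB by simp
        moreover have "f - z \<noteq> x" using False fx inv[OF z] by auto
        ultimately show ?thesis using inv[OF z] by (metis DiffI UnI2 image_eqI singletonD)
      qed simp
    qed
    then have "card ?B \<le> card (U \<union> (\<lambda>z. f - z) ` (U - {x}))" using fU by (intro card_mono) auto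
    also have "\<dots> \<le> card U + card ((\<lambda>z. f - z) ` (U - {x}))" by (rule card_Un_le)
    also have "\<dots> \<le> card U + card (U - {x})" using fU by (simp add: card_image_le)
    also have "\<dots> < 2 * card U" using x fU card_Diff1_less[OF fU x] by linarith
    finally show False using U(2) g by linarith
  qed
  \<comment> \<open>Compared with \<open>?B - U\<close>, the set gains \<open>f\<close>, which lies
    in \<open>U\<close>, and loses \<open>0\<close>, which does not; the size stays
    \<open>g\<close>.\<close>
  define G where "G = insert f (?B - U - {0})"
  define S where "S = C - G"
  have GB: "G \<subseteq> ?B" and BC: "?B \<subseteq> C" using Bf by (auto simp: G_def cone_box_def)
  then have CS: "C - S = G" by (auto simp: S_def)
  have "card G = Suc (card (?B - U - {0}))" using fin Uf by (simp add: G_def)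
  also have "\<dots> = card (?B - U)" using fin B0 U0 by (intro card.remove[symmetric]) auto
  also have "\<dots> = g" using U(1,2) fU g by (simp add: card_Diff_subset)
  finally have genus: "genus C S = g" by (simp add: genus_def CS)
  have add: "x + y \<in> S" if xy: "x \<in> S" "y \<in> S" for x y
  proof (cases "x = 0 \<or> y = 0")
    case False
    have xyC: "x \<in> C" "y \<in> C" using xy by (auto simp: S_def)
    \<comment> \<open>All gaps lie in the box, so it suffices that a sum of two non-zero elements of
      \<open>S\<close> leaves it.\<close>
    have "x + y \<notin> ?B"
    proof
      assume B: "x + y \<in> ?B"
      then have xB: "x \<in> ?B" and yB: "y \<in> ?B"
        using cone_box_of_add[OF C] xyC by (blast, metis add.commute)
      then have xU: "x \<in> U" and yU: "y \<in> U" using xy False by (auto simp: S_def G_def)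
      \<comment> \<open>Here \<open>f - x = y + c\<close> dominates \<open>y\<close>, so upward
        closure puts it in \<open>U\<close> together with \<open>x\<close>.\<close>
      obtain c where c: "f = x + y + c" using B by (auto simp: mem_cone_box_iff)
      have "le (0 + y) (c + y)" by (rule mono[OF le0])
      then have "le y (f - x)" using c by (simp add: add.assoc add.commute[of c])
      then have "f - x \<in> U" using U(3)[OF yU] cone_box_diff(1)[OF xB] by blast
      then show False using no_pair[OF xU] by blast
    qed
    then show ?thesis using affine_integer_cone_add[OF C xyC] GB by (auto simp: S_def)
  qed (use xy in auto)
  have "0 \<in> S" using C0 f by (auto simp: S_def G_def)
  then have "C_semigroup C S"
    using add CS finite_subset[OF GB fin] by (auto simp: C_semigroup_def S_def)
  moreover have "Fb le C S = f"
    by (rule Fb_eqI[OF le]) (use CS GB Ble in \<open>auto simp: G_def\<close>)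
  moreover have "S \<noteq> C" using CS by (auto simp: G_def)
  moreover have "S = S \<union> (C - ?B)" using GB by (auto simp: S_def)
  ultimately show ?thesis using genus unfolding B_semigroup_def by blast
qed

theorem proposition14:
  fixes C :: "(nat ^ 'p) set"
    and le :: "nat ^ 'p \<Rightarrow> nat ^ 'p \<Rightarrow> bool"
    and f :: "nat ^ 'p"
    and g :: nat
  assumes "affine_integer_cone C"
    and "monoid_total_order le"
    and "f \<in> C - {0}"
    and "g > 0"
  shows "B_semigroups le C f g \<noteq> {} \<longleftrightarrow>
    \<lceil>real (card (cone_box C f)) / 2\<rceil> \<le> int g \<and> int g \<le> int (card (cone_box C f)) - 1"
proof -
  have "\<lceil>real (card (cone_box C f)) / 2\<rceil> \<le> int g \<longleftrightarrow> card (cone_box C f) \<le> 2 * g"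
    by (simp add: ceiling_le_iff field_simps) linarith
  moreover have "int g \<le> int (card (cone_box C f)) - 1 \<longleftrightarrow> g < card (cone_box C f)" by linarith
  moreover have "B_semigroups le C f g \<noteq> {} \<longleftrightarrow> (\<exists>S. B_semigroup le C f S \<and> genus C S = g)"
    by (auto simp: B_semigroups_def)
  ultimately show ?thesis
    using genus_bounds[OF assms(1,2)] B_semigroup_exists[OF assms(1,2)] assms(3) by blast
qed

end
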